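(* Let $p>3$ be a prime and let $a\in\mathbb Z_p$ with $2a+1\not\equiv 0\pmod p$. Put $t=(a-\langle a\rangle_p)/p$. Then $$\sum_{k=0}^{p-1}\binom ak\binom{-1-a}k\frac{a+k+1}{2k+1}\equiv \frac{1+(-1)^{\langle a\rangle_p}}2+t+p^2\frac{t(t+1)}4B_{p-2}\Big(-\frac a2\Big)\pmod{p^3}.$$
   Context: $\mathbb Z_p$ denotes the set of rational numbers whose denominator is not divisible by $p$. For $x,y\in\mathbb Q$, $x\equiv y\pmod{p^m}$ means $(x-y)/p^m\in\mathbb Z_p$. For $a\in\mathbb Z_p$, $\langle a\rangle_p\in\{0,1,\ldots,p-1\}$ is defined by $a\equiv\langle a\rangle_p\pmod p$. For rational $a$ and integer $k\ge0$, $\binom ak=a(a-1)\cdots(a-k+1)/k!$. The Bernoulli numbers are defined by $B_0=1$, $\sum_{k=0}^{n-1}\binom nkB_k=0$ for $n\ge2$, and the Bernoulli polynomials by $B_n(x)=\sum_{k=0}^n\binom nkB_kx^{n-k}$. *)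

theory Defs
  imports Complex_Main "HOL-Computational_Algebra.Primes"
begin

text \<open>
  Rational numbers whose denominator in lowest terms is not divisible by \<open>p\<close>
  (\<open>quotient_of\<close> returns the reduced fraction with positive denominator).
\<close>

definition Zloc :: "nat \<Rightarrow> rat set" where
  "Zloc p = {x. \<not> int p dvd snd (quotient_of x)}"

definition cong_pow :: "nat \<Rightarrow> nat \<Rightarrow> rat \<Rightarrow> rat \<Rightarrow> bool" where
  "cong_pow p m x y \<longleftrightarrow> (x - y) / of_nat p ^ m \<in> Zloc p"

text \<open>
  The least nonnegative residue of \<open>a\<close> modulo \<open>p\<close>; it is meaningful for
  \<open>p\<close> prime and \<open>a \<in> Zloc p\<close>, where such an \<open>r\<close> exists and is unique.
\<close>

definition least_res :: "nat \<Rightarrow> rat \<Rightarrow> nat" where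
  "least_res p a = (THE r. r < p \<and> cong_pow p 1 a (of_nat r))"

declare sum.cong [fundef_cong]

text \<open>
  The recursion is \<open>(\<Sum>k<n. (n choose k) * B\<^sub>k) = 0\<close> for \<open>n = m + 2\<close>, solved for its
  last term \<open>n * B\<^sub>m\<^sub>+\<^sub>1\<close>; so the first Bernoulli number is \<open>- 1 / 2\<close>.
\<close>

fun bernoulli_num :: "nat \<Rightarrow> rat" where
  "bernoulli_num 0 = 1"
| "bernoulli_num (Suc m) =
     - (\<Sum>k\<le>m. of_nat ((m + 2) choose k) * bernoulli_num k) / of_nat (m + 2)"

lemma bernoulli_num_rec:
  assumes "n \<ge> 2"
  shows "(\<Sum>k<n. of_nat (n choose k) * bernoulli_num k) = 0"
proof -
  obtain m where n: "n = m + 2"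
    using assms by (metis le_add_diff_inverse2)
  have "(m + 2) choose (Suc m) = m + 2"
    by (simp add: binomial_symmetric[of "Suc m" "m + 2"])
  moreover have "{..<n} = insert (Suc m) {..m}"
    using n by auto
  moreover have "(of_nat (m + 2) :: rat) \<noteq> 0"
    by (metis add_eq_0_iff_both_eq_0 of_nat_eq_0_iff zero_neq_numeral)
  ultimately show ?thesis
    unfolding n by (simp del: of_nat_add binomial_Suc_Suc)
qed

definition bernoulli_poly :: "nat \<Rightarrow> rat \<Rightarrow> rat" where
  "bernoulli_poly n x = (\<Sum>k\<le>n. of_nat (n choose k) * bernoulli_num k * x ^ (n - k))"

end

theory Submission
  imports Defs "HOL-Computational_Algebra.Formal_Power_Series" "HOL-Number_Theory.Number_Theory"
begin

text \<open>
  Let \<open>F a\<close> be the sum in question and \<open>Q a = (\<Prod>j<p. 1 - a\<^sup>2 / j\<^sup>2)\<close> (over \<open>j \<ge> 1\<close>). Write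
  \<open>F = (S + T) / 2\<close>, where \<open>S\<close> and \<open>T\<close> carry the weights \<open>1\<close> and \<open>(2 a + 1) / (2 k + 1)\<close>.
  The sums \<open>S a + S (a - 1)\<close> and \<open>T a - T (a - 1)\<close> both telescope to \<open>2 Q a\<close>, so
  \<open>F a - F (a - 2) = 2 Q a\<close>. For a natural number \<open>a\<close> the product \<open>Q a\<close> is known modulo
  \<open>p\<^sup>3\<close>: if \<open>p\<close> divides \<open>a\<close> it is \<open>1\<close>, and otherwise
  \<open>a\<^sup>2 Q a = p\<^sup>2 (a choose p) (a + p - 1 choose p)\<close> with \<open>a choose p \<equiv> a div p\<close> modulo \<open>p\<close>.
  By the difference equation and the reflection formula of the Bernoulli polynomials the
  right-hand side has the same increments modulo \<open>p\<^sup>3\<close>, which settles natural \<open>a\<close> by induction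
  in steps of 2. Both sides depend \<open>p\<close>-adically continuously on \<open>a\<close>: it is enough to
  approximate \<open>a\<close> by a natural number modulo \<open>p\<^sup>4\<close>, where one power of \<open>p\<close> is lost to the
  denominator \<open>2 k + 1 = p\<close> and to the division by \<open>p\<close> in \<open>t\<close>.
\<close>

subsection \<open>Congruences in the local ring\<close>

context
  fixes p :: nat
  assumes p: "prime p"
begin

text \<open>Membership can thus be tested on any representing fraction, which is how all closure
  properties are proved. If p divided the reduced denominator, cross-multiplication would make it
  divide the reduced numerator too, against coprimality.\<close>

lemma Zloc_iff: "x \<in> Zloc p \<longleftrightarrow> (\<exists>u v. x = of_int u / of_int v \<and> \<not> int p dvd v)"
proof
  assume "x \<in> Zloc p"
  then show "\<exists>u v. x = of_int u / of_int v \<and> \<not> int p dvd v"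
    unfolding Zloc_def
    by (metis (mono_tags, lifting) mem_Collect_eq prod.collapse quotient_of_div)
next
  assume "\<exists>u v. x = of_int u / of_int v \<and> \<not> int p dvd v"
  then obtain u v where x: "x = of_int u / of_int v" and v: "\<not> int p dvd v"
    by blast
  obtain u' v' where q: "quotient_of x = (u', v')"
    by fastforce
  have x': "x = of_int u' / of_int v'" and v'0: "v' > 0" and cop: "coprime u' v'"
    using q quotient_of_div quotient_of_denom_pos quotient_of_coprime by auto
  have "v \<noteq> 0"
    using v by auto
  have "rat_of_int (u' * v) = of_int (u * v')"
    using x x' v'0 \<open>v \<noteq> 0\<close> by (simp add: field_simps)
  then have eq: "u' * v = u * v'"
    using of_int_eq_iff by blast
  have "\<not> int p dvd v'"
  proof
    assume d: "int p dvd v'"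
    then have "int p dvd u' * v"
      by (simp add: eq)
    then have "int p dvd u'"
      using v p prime_dvd_mult_iff[of "int p"] by auto
    then have "is_unit (int p)"
      using d cop coprime_common_divisor by blast
    then show False
      using p not_prime_unit prime_nat_int_transfer by blast
  qed
  then show "x \<in> Zloc p"
    by (simp add: Zloc_def q)
qed

lemma Zloc_of_int [simp, intro]: "of_int u \<in> Zloc p"
proof -
  have "\<not> int p dvd 1"
    using p not_prime_unit prime_nat_int_transfer by blast
  then show ?thesis
    unfolding Zloc_iff by (metis div_by_1 of_int_1)
qed

lemma Zloc_of_nat [simp, intro]: "of_nat n \<in> Zloc p"
  using Zloc_of_int[of "int n"] by simp

lemma Zloc_0 [simp, intro]: "0 \<in> Zloc p"
  and Zloc_1 [simp, intro]: "1 \<in> Zloc p"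
  and Zloc_numeral [simp, intro]: "numeral w \<in> Zloc p"
  using Zloc_of_nat[of 0] Zloc_of_nat[of 1] Zloc_of_nat[of "numeral w"] by simp_all

lemma Zloc_mult [simp, intro]:
  assumes "x \<in> Zloc p" "y \<in> Zloc p"
  shows "x * y \<in> Zloc p"
proof -
  obtain u v u' v' where "x = of_int u / of_int v" "\<not> int p dvd v"
    "y = of_int u' / of_int v'" "\<not> int p dvd v'"
    using assms unfolding Zloc_iff by blast
  then have "x * y = of_int (u * u') / of_int (v * v')" "\<not> int p dvd v * v'"
    using p prime_dvd_mult_iff[of "int p"] by auto
  then show ?thesis
    unfolding Zloc_iff by blast
qed

lemma Zloc_add [simp, intro]:
  assumes "x \<in> Zloc p" "y \<in> Zloc p"
  shows "x + y \<in> Zloc p"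
proof -
  obtain u v u' v' where *: "x = of_int u / of_int v" "\<not> int p dvd v"
    "y = of_int u' / of_int v'" "\<not> int p dvd v'"
    using assms unfolding Zloc_iff by blast
  then have "v \<noteq> 0" "v' \<noteq> 0"
    by auto
  then have "x + y = of_int (u * v' + u' * v) / of_int (v * v')"
    using * by (simp add: field_simps)
  moreover have "\<not> int p dvd v * v'"
    using * p prime_dvd_mult_iff[of "int p"] by auto
  ultimately show ?thesis
    unfolding Zloc_iff by blast
qed

lemma Zloc_uminus [simp, intro]: "x \<in> Zloc p \<Longrightarrow> - x \<in> Zloc p"
  using Zloc_mult[OF Zloc_of_int[of "-1"]] by simp

lemma Zloc_diff [simp, intro]: "x \<in> Zloc p \<Longrightarrow> y \<in> Zloc p \<Longrightarrow> x - y \<in> Zloc p"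
  using Zloc_add[of x "- y"] by auto

lemma Zloc_power [simp, intro]: "x \<in> Zloc p \<Longrightarrow> x ^ n \<in> Zloc p"
  by (induction n) auto

lemma Zloc_sum [intro]: "(\<And>i. i \<in> A \<Longrightarrow> f i \<in> Zloc p) \<Longrightarrow> sum f A \<in> Zloc p"
  by (induction A rule: infinite_finite_induct) auto

lemma Zloc_divide_nat [intro]:
  assumes "x \<in> Zloc p" "\<not> p dvd n"
  shows "x / of_nat n \<in> Zloc p"
proof -
  have "\<not> int p dvd int n"
    using assms by simp
  then have "1 / of_nat n \<in> Zloc p"
    unfolding Zloc_iff by (metis of_int_1 of_int_of_nat_eq)
  then show ?thesis
    using Zloc_mult[OF assms(1)] by fastforce
qed

section \<open>Calculus of congruences modulo powers of p\<close>

lemma cong_pow_iff: "cong_pow p m x y \<longleftrightarrow> (\<exists>z\<in>Zloc p. x = y + of_nat p ^ m * z)"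
proof -
  have "(of_nat p :: rat) \<noteq> 0"
    using p by (simp add: prime_gt_0_nat)
  then have "x = y + of_nat p ^ m * z \<longleftrightarrow> (x - y) / of_nat p ^ m = z" for z
    by (auto simp: field_simps)
  then show ?thesis
    unfolding cong_pow_def by auto
qed

lemma cong_powI: "x = y + of_nat p ^ m * z \<Longrightarrow> z \<in> Zloc p \<Longrightarrow> cong_pow p m x y"
  unfolding cong_pow_iff by blast

lemma cong_pow_refl [simp, intro]: "cong_pow p m x x"
  by (auto intro: cong_powI[where z = 0])

lemma cong_pow_add: "cong_pow p m x y \<Longrightarrow> cong_pow p m x' y' \<Longrightarrow> cong_pow p m (x + x') (y + y')"
proof -
  assume "cong_pow p m x y" "cong_pow p m x' y'"
  then obtain z z' where "z \<in> Zloc p" "z' \<in> Zloc p" "x = y + of_nat p ^ m * z" "x' = y' + of_nat p ^ m * z'"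
    unfolding cong_pow_iff by blast
  then show ?thesis
    by (intro cong_powI[where z = "z + z'"]) (auto simp: algebra_simps)
qed

lemma cong_pow_mult:
  assumes "cong_pow p m x y" "cong_pow p m x' y'" "y \<in> Zloc p" "y' \<in> Zloc p"
  shows "cong_pow p m (x * x') (y * y')"
proof -
  obtain z z' where "z \<in> Zloc p" "z' \<in> Zloc p" "x = y + of_nat p ^ m * z" "x' = y' + of_nat p ^ m * z'"
    using assms unfolding cong_pow_iff by blast
  then show ?thesis
    using assms(3,4)
    by (intro cong_powI[where z = "y * z' + z * y' + of_nat p ^ m * z * z'"])
      (auto simp: algebra_simps)
qed

lemma cong_pow_cmult: "cong_pow p m x y \<Longrightarrow> c \<in> Zloc p \<Longrightarrow> cong_pow p m (c * x) (c * y)"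
  unfolding cong_pow_def by (metis Zloc_mult right_diff_distrib times_divide_eq_right)

lemma cong_pow_sym: "cong_pow p m x y \<Longrightarrow> cong_pow p m y x"
  unfolding cong_pow_def by (metis Zloc_uminus minus_diff_eq minus_divide_left)

lemma cong_pow_trans: "cong_pow p m x y \<Longrightarrow> cong_pow p m y z \<Longrightarrow> cong_pow p m x z"
  using cong_pow_add[of m x y y z] unfolding cong_pow_def by simp

lemma cong_pow_diff: "cong_pow p m x y \<Longrightarrow> cong_pow p m x' y' \<Longrightarrow> cong_pow p m (x - x') (y - y')"
  using cong_pow_add[of m x y "-x'" "-y'"] cong_pow_cmult[of m x' y' "-1"] by simp

lemma cong_pow_sum:
  "(\<And>i. i \<in> A \<Longrightarrow> cong_pow p m (f i) (g i)) \<Longrightarrow> cong_pow p m (sum f A) (sum g A)"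
  by (induction A rule: infinite_finite_induct) (auto intro: cong_pow_add)

lemma cong_pow_power: "cong_pow p m x y \<Longrightarrow> y \<in> Zloc p \<Longrightarrow> cong_pow p m (x ^ n) (y ^ n)"
  by (induction n) (auto intro: cong_pow_mult)

lemma cong_pow_lift: "cong_pow p m x y \<Longrightarrow> cong_pow p (k + m) (of_nat p ^ k * x) (of_nat p ^ k * y)"
  unfolding cong_pow_iff by (auto simp: algebra_simps power_add)

lemma cong_pow_mono:
  assumes "cong_pow p m x y" "k \<le> m"
  shows "cong_pow p k x y"
proof -
  obtain z where z: "z \<in> Zloc p" "x = y + of_nat p ^ m * z"
    using assms cong_pow_iff by blast
  then show ?thesis
    using assms(2)
    by (intro cong_powI[where z = "of_nat p ^ (m - k) * z"])
       (auto simp flip: mult.assoc power_add)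
qed

lemma cong_pow_of_nat:
  assumes "[m = n] (mod p ^ k)"
  shows "cong_pow p k (of_nat m) (of_nat n)"
proof -
  have "[int m = int n] (mod int p ^ k)"
    using assms by (metis cong_int_iff of_nat_power)
  then obtain z where "int m = int n + int p ^ k * z"
    by (metis cong_iff_lin cong_sym)
  then have "rat_of_int (int m) = rat_of_int (int n + int p ^ k * z)"
    by simp
  then show ?thesis
    by (intro cong_powI[where z = "of_int z"]) auto
qed

lemma cong_pow_of_nat_iff: "cong_pow p 1 (of_nat m) (of_nat n) \<longleftrightarrow> [m = n] (mod p)"
proof
  assume "cong_pow p 1 (of_nat m) (of_nat n)"
  then obtain z where z: "z \<in> Zloc p" "rat_of_nat m = of_nat n + of_nat p * z"
    unfolding cong_pow_iff by auto
  obtain u v where uv: "z = of_int u / of_int v" "\<not> int p dvd v"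
    using z Zloc_iff by blast
  then have "v \<noteq> 0"
    by auto
  then have "rat_of_int ((int m - int n) * v) = of_int (int p * u)"
    using uv z by (simp add: field_simps)
  then have "(int m - int n) * v = int p * u"
    using of_int_eq_iff by blast
  then have "int p dvd int m - int n"
    by (metis dvd_triv_left p prime_dvd_mult_iff prime_nat_int_transfer uv(2))
  then show "[m = n] (mod p)"
    using cong_iff_dvd_diff cong_int_iff by blast
qed (use cong_pow_of_nat[of m n 1] in auto)

lemma cong_pow_cancel_nat:
  assumes "cong_pow p m (of_nat n * x) (of_nat n * y)" "\<not> p dvd n"
  shows "cong_pow p m x y"
proof -
  have "n \<noteq> 0"
    using assms(2) by (cases n) auto
  then show ?thesis
    using cong_pow_cmult[OF assms(1), of "1 / of_nat n"] Zloc_divide_nat[OF Zloc_1 assms(2)]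
    by simp
qed

text \<open>Natural numbers are p-adically dense: the denominator \<open>v\<close> has an inverse
  \<open>w\<close> modulo \<open>p ^ k\<close>, and the residue of \<open>u * w\<close> serves as
  \<open>n\<close>.\<close>

lemma Zloc_approx:
  assumes "x \<in> Zloc p"
  obtains n where "cong_pow p k x (of_nat n)"
proof -
  obtain u v where uv: "x = of_int u / of_int v" "\<not> int p dvd v"
    using assms Zloc_iff by blast
  have "coprime v (int p ^ k)"
    using uv(2) p by (metis coprime_commute coprime_power_left_iff prime_imp_coprime prime_nat_int_transfer)
  then obtain w where w: "[v * w = 1] (mod int p ^ k)"
    using cong_solve_coprime_int by blast
  define n where "n = nat ((u * w) mod int p ^ k)"
  have pk: "int p ^ k > 0"
    using p by (simp add: prime_gt_0_nat)
  have "[v * int n = u] (mod int p ^ k)"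
  proof -
    have "[int n = u * w] (mod int p ^ k)"
      unfolding n_def using pk by (simp add: cong_def)
    then have "[v * int n = u * (v * w)] (mod int p ^ k)"
      by (metis cong_scalar_left mult.left_commute)
    also have "[u * (v * w) = u * 1] (mod int p ^ k)"
      using w cong_scalar_left by blast
    finally show ?thesis
      by simp
  qed
  then obtain z where "u = v * int n + int p ^ k * z"
    by (metis cong_iff_lin)
  moreover have "v \<noteq> 0"
    using uv by auto
  ultimately have "x = of_nat n + of_nat p ^ k * (of_int z / of_int v)"
    using uv(1) by (simp add: field_simps)
  moreover have "of_int z / of_int v \<in> Zloc p"
    unfolding Zloc_iff using uv by blast
  ultimately show ?thesis
    using that cong_powI by blast
qed

text \<open>Makes the definite description computable: any natural approximation of \<open>x\<close>
  yields the residue, unique because congruent naturals below p coincide.\<close>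

lemma least_res_eq:
  assumes "cong_pow p k x (of_nat n)" "k \<ge> 1"
  shows "least_res p x = n mod p"
proof -
  have 1: "cong_pow p 1 x (of_nat n)"
    using assms cong_pow_mono by blast
  show ?thesis
    unfolding least_res_def
  proof (rule the_equality)
    have "cong_pow p 1 (of_nat n) (of_nat (n mod p))"
      by (simp add: cong_pow_of_nat_iff[simplified])
    then show "n mod p < p \<and> cong_pow p 1 x (of_nat (n mod p))"
      using 1 p cong_pow_trans prime_gt_0_nat by (metis mod_less_divisor)
  next
    fix r
    assume "r < p \<and> cong_pow p 1 x (of_nat r)"
    then have "[r = n] (mod p)" "r < p"
      using 1 cong_pow_sym cong_pow_trans cong_pow_of_nat_iff by blast+
    then show "r = n mod p"
      by (simp add: cong_def)
  qed
qed

text \<open>Fermat's little theorem carries over from a natural number congruent to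
  \<open>x\<close>.\<close>

lemma fermat_Zloc:
  assumes "x \<in> Zloc p" "\<not> cong_pow p 1 x 0"
  shows "cong_pow p 1 (x ^ (p - 1)) 1"
proof -
  obtain n where n: "cong_pow p 1 x (of_nat n)"
    using Zloc_approx assms by blast
  then have "\<not> p dvd n"
    using assms(2) cong_pow_trans cong_pow_of_nat_iff[of n 0] by (auto simp: cong_0_iff)
  then have "[n ^ (p - 1) = 1] (mod p)"
    using p fermat_theorem by blast
  then have "cong_pow p 1 (of_nat n ^ (p - 1)) 1"
    using cong_pow_of_nat_iff[of "n ^ (p - 1)" 1] by simp
  then show ?thesis
    using cong_pow_power[OF n, of "p - 1"] cong_pow_trans by blast
qed

end

subsection \<open>Bernoulli polynomials\<close>

text \<open>The exponential generating function, that is X / (exp X - 1).\<close>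

definition bernoulli_fps :: "rat fps" where
  "bernoulli_fps = Abs_fps (\<lambda>n. bernoulli_num n / fact n)"

text \<open>The n-th coefficient is the defining recursion divided by n!; the term k = n drops out
  because exp X - 1 has constant term 0. Only n = 1 gives a nonzero value.\<close>

lemma bernoulli_fps_exp: "bernoulli_fps * (fps_exp 1 - 1) = fps_X"
proof (rule fps_ext)
  fix n
  have "fps_nth (bernoulli_fps * (fps_exp 1 - 1)) n =
    (\<Sum>k\<in>{0..n}. bernoulli_num k / fact k * (if k = n then 0 else 1 / fact (n - k)))"
    unfolding fps_mult_nth bernoulli_fps_def by (intro sum.cong) auto
  also have "\<dots> = (\<Sum>k<n. bernoulli_num k / fact k * (1 / fact (n - k)))"
    by (intro sum.mono_neutral_cong_right) auto
  also have "\<dots> = (\<Sum>k<n. of_nat (n choose k) * bernoulli_num k) / fact n"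
    unfolding sum_divide_distrib
    by (intro sum.cong) (auto simp: binomial_fact field_simps)
  also have "\<dots> = fps_nth fps_X n"
  proof (cases "n \<ge> 2")
    case True
    then show ?thesis
      using bernoulli_num_rec[OF True] by simp
  next
    case False
    then have "n = 0 \<or> n = 1"
      by auto
    then show ?thesis
      by auto
  qed
  finally show "fps_nth (bernoulli_fps * (fps_exp 1 - 1)) n = fps_nth fps_X n" .
qed

lemma fps_nth_bernoulli_poly:
  "fps_nth (bernoulli_fps * fps_exp x) n = bernoulli_poly n x / fact n"
  unfolding fps_mult_nth bernoulli_fps_def bernoulli_poly_def sum_divide_distrib atLeast0AtMost
  by (intro sum.cong) (auto simp: binomial_fact field_simps)

text \<open>Raising x by 1 multiplies the generating function by exp X, so the difference contains
  the factor exp X - 1, which cancels the denominator and leaves X exp(xX).\<close>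

lemma bernoulli_poly_plus_1:
  "bernoulli_poly (Suc n) (x + 1) - bernoulli_poly (Suc n) x = of_nat (Suc n) * x ^ n"
proof -
  have "bernoulli_fps * fps_exp (x + 1) - bernoulli_fps * fps_exp x =
      bernoulli_fps * (fps_exp 1 - 1) * fps_exp x"
    by (simp add: fps_exp_add_mult algebra_simps)
  also have "\<dots> = fps_X * fps_exp x"
    by (simp add: bernoulli_fps_exp)
  finally have "fps_nth (bernoulli_fps * fps_exp (x + 1) - bernoulli_fps * fps_exp x) (Suc n) =
      fps_nth (fps_X * fps_exp x) (Suc n)"
    by simp
  then have "bernoulli_poly (Suc n) (x + 1) / fact (Suc n) - bernoulli_poly (Suc n) x / fact (Suc n)
      = x ^ n / fact n"
    by (simp only: fps_sub_nth fps_nth_bernoulli_poly) simp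
  then have "(bernoulli_poly (Suc n) (x + 1) - bernoulli_poly (Suc n) x) / fact (Suc n) = x ^ n / fact n"
    by (simp only: diff_divide_distrib)
  then have "(bernoulli_poly (Suc n) (x + 1) - bernoulli_poly (Suc n) x) =
      fact (Suc n) / fact n * x ^ n"
    by (simp add: divide_eq_eq del: fact_Suc)
  then show ?thesis
    by simp
qed

text \<open>Substituting -X for X multiplies coefficient n by (-1)^n, and it turns X / (exp X - 1)
  into the same series times exp X. Hence exp(xX) is replaced by exp((1 - x)X).\<close>

lemma bernoulli_poly_reflect: "bernoulli_poly n (1 - x) = (-1) ^ n * bernoulli_poly n x"
proof -
  have c0: "fps_nth (- fps_X :: rat fps) 0 = 0"
    by simp
  let ?B = "bernoulli_fps oo (- fps_X)"
  have exp: "fps_exp c oo (- fps_X) = fps_exp (- c)" for c :: rat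
    using fps_exp_compose_linear[of c "-1"] by (simp flip: fps_const_neg)
  have "?B * (fps_exp (-1) - 1) = (bernoulli_fps * (fps_exp 1 - 1)) oo (- fps_X)"
    by (simp add: fps_compose_mult_distrib[OF c0] fps_compose_sub_distrib exp)
  then have "?B * (fps_exp (-1) - 1) * fps_exp 1 = - fps_X * fps_exp 1"
    by (simp add: bernoulli_fps_exp)
  moreover have "(fps_exp (-1) - 1) * fps_exp 1 = - (fps_exp 1 - 1 :: rat fps)"
    using fps_exp_add_mult[of "-1" "1::rat"] by (simp add: algebra_simps)
  ultimately have "?B * - (fps_exp 1 - 1) = - fps_X * fps_exp 1"
    by (simp only: mult.assoc)
  then have "?B * (fps_exp 1 - 1) = fps_X * fps_exp 1"
    by (simp only: mult_minus_right mult_minus_left neg_equal_iff_equal)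
  also have "\<dots> = bernoulli_fps * fps_exp 1 * (fps_exp 1 - 1)"
    by (subst bernoulli_fps_exp[symmetric]) (simp only: ac_simps)
  finally have "?B * (fps_exp 1 - 1) = bernoulli_fps * fps_exp 1 * (fps_exp 1 - 1)" .
  \<comment> \<open>Power series over the rationals form an integral domain, so this factor may be
    cancelled.\<close>
  moreover have "fps_exp 1 - 1 \<noteq> (0 :: rat fps)"
    using bernoulli_fps_exp by fastforce
  ultimately have B: "?B = bernoulli_fps * fps_exp 1"
    by simp
  have "(bernoulli_fps * fps_exp x) oo (- fps_X) = ?B * fps_exp (- x)"
    by (simp add: fps_compose_mult_distrib[OF c0] exp)
  also have "\<dots> = bernoulli_fps * fps_exp (1 - x)"
    using fps_exp_add_mult[of 1 "-x"] by (simp add: B mult.assoc)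
  finally have "fps_nth ((bernoulli_fps * fps_exp x) oo (- fps_X)) n =
      fps_nth (bernoulli_fps * fps_exp (1 - x)) n"
    by simp
  then have "(-1) ^ n * (bernoulli_poly n x / fact n) = bernoulli_poly n (1 - x) / fact n"
    by (simp only: fps_compose_uminus' fps_nth_Abs_fps fps_nth_bernoulli_poly)
  then show ?thesis
    by simp
qed

lemma bernoulli_poly_odd_half: "odd n \<Longrightarrow> bernoulli_poly n (1 / 2) = 0"
  using bernoulli_poly_reflect[of n "1 / 2"] by simp

text \<open>The values at 0 and 1 agree by the difference equation and are opposite by
  reflection.\<close>

lemma bernoulli_poly_odd_0:
  assumes "odd n" "n \<noteq> 1"
  shows "bernoulli_poly n 0 = 0"
proof -
  obtain m where m: "n = Suc m"
    using assms(1) by (cases n) auto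
  then have "m \<noteq> 0"
    using assms(2) by simp
  then have "bernoulli_poly n 1 = bernoulli_poly n 0"
    using bernoulli_poly_plus_1[of m 0] m by (simp add: zero_power)
  then show ?thesis
    using bernoulli_poly_reflect[of n 0] assms(1) by simp
qed

section \<open>Integrality at p of Bernoulli numbers and polynomials of small index\<close>

lemma bernoulli_num_Zloc: "prime p \<Longrightarrow> n + 1 < p \<Longrightarrow> bernoulli_num n \<in> Zloc p"
proof (induction n rule: less_induct)
  case (less n)
  show ?case
  proof (cases n)
    case 0
    then show ?thesis
      using less by simp
  next
    case (Suc m)
    \<comment> \<open>The recursion divides only by \<open>m + 2 = n + 1\<close>, which is smaller
      than p.\<close>
    have "\<not> p dvd m + 2"
      using less.prems Suc by (auto dest: dvd_imp_le)
    then show ?thesis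
      unfolding Suc bernoulli_num.simps using less Suc
      by (intro Zloc_divide_nat Zloc_uminus Zloc_sum Zloc_mult) auto
  qed
qed

lemma bernoulli_poly_Zloc:
  "prime p \<Longrightarrow> n + 1 < p \<Longrightarrow> x \<in> Zloc p \<Longrightarrow> bernoulli_poly n x \<in> Zloc p"
  unfolding bernoulli_poly_def
  by (intro Zloc_sum Zloc_mult) (auto intro: bernoulli_num_Zloc)

lemma bernoulli_poly_cong:
  "prime p \<Longrightarrow> n + 1 < p \<Longrightarrow> cong_pow p m x y \<Longrightarrow> y \<in> Zloc p \<Longrightarrow>
    cong_pow p m (bernoulli_poly n x) (bernoulli_poly n y)"
  unfolding bernoulli_poly_def
  by (intro cong_pow_sum cong_pow_cmult cong_pow_power) (auto intro!: bernoulli_num_Zloc Zloc_mult)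

subsection \<open>The difference equation\<close>

definition binom_prod :: "rat \<Rightarrow> nat \<Rightarrow> rat" where
  "binom_prod a k = (a gchoose k) * ((-1 - a) gchoose k)"

definition sq_prod :: "nat \<Rightarrow> rat \<Rightarrow> rat" where
  "sq_prod n a = (\<Prod>j=1..n. 1 - a ^ 2 / of_nat j ^ 2)"

lemma sq_prod_0 [simp]: "sq_prod 0 a = 1"
  and sq_prod_Suc: "sq_prod (Suc n) a = sq_prod n a * (1 - a ^ 2 / of_nat (Suc n) ^ 2)"
  by (simp_all add: sq_prod_def)

lemma gbinomial_Suc_right: "(a::rat) gchoose Suc k = (a gchoose k) * (a - of_nat k) / of_nat (Suc k)"
  using gbinomial_mult_1[of a k] by (simp add: field_simps)

text \<open>In the numerators the factors a - j and a + j for j = 1..k pair up to a^2 - j^2; what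
  remains is a and a + k + 1.\<close>

lemma binom_prod_Suc:
  "binom_prod a (Suc k) = - a * (of_nat (Suc k) + a) / of_nat (Suc k) ^ 2 * sq_prod k a"
proof (induction k)
  case 0
  then show ?case
    by (simp add: binom_prod_def algebra_simps)
next
  case (Suc k)
  define c where "c = rat_of_nat (Suc k)"
  have c: "c \<noteq> 0" "1 + c \<noteq> 0" "c + 1 \<noteq> 0" "rat_of_nat (Suc (Suc k)) = c + 1"
    unfolding c_def by (simp_all del: of_nat_Suc add: of_nat_Suc[of "Suc k"])
  have "binom_prod a (Suc (Suc k)) =
      binom_prod a (Suc k) * ((a - c) * (- 1 - a - c)) / (c + 1) ^ 2"
    unfolding binom_prod_def
      gbinomial_Suc_right[of a "Suc k"] gbinomial_Suc_right[of "-1 - a" "Suc k"] c(4)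
    unfolding c_def[symmetric] by (simp add: power2_eq_square)
  also have "\<dots> = - a * (c + 1 + a) / (c + 1) ^ 2 * (sq_prod k a * (1 - a ^ 2 / c ^ 2))"
    unfolding Suc.IH c_def[symmetric] using c(1-3) by (simp add: divide_simps) (simp add: algebra_simps power2_eq_square)
  finally show ?case
    unfolding sq_prod_Suc c(4) c_def[symmetric] .
qed

text \<open>Replacing a by -1 - a swaps the two binomials, so the values at a - 1 and -a coincide,
  while \<open>sq_prod\<close> is even in a.\<close>

lemma binom_prod_minus_1_Suc:
  "binom_prod (a - 1) (Suc k) = a * (of_nat (Suc k) - a) / of_nat (Suc k) ^ 2 * sq_prod k a"
proof -
  have "binom_prod (a - 1) (Suc k) = binom_prod (- a) (Suc k)"
    by (simp add: binom_prod_def mult.commute algebra_simps)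
  then show ?thesis
    using binom_prod_Suc[of "- a" k] by (simp add: sq_prod_def)
qed

text \<open>With c = k + 1, the terms of index c add up to -2 a^2 / c^2 times
  \<open>sq_prod k a\<close>, which is twice the increment of \<open>sq_prod\<close>.\<close>

lemma sum_binom_prod_step:
  "(\<Sum>k\<le>n. binom_prod a k) + (\<Sum>k\<le>n. binom_prod (a - 1) k) = 2 * sq_prod n a"
proof (induction n)
  case 0
  then show ?case
    by (simp add: binom_prod_def)
next
  case (Suc n)
  define c where "c = rat_of_nat (Suc n)"
  have "c \<noteq> 0"
    unfolding c_def by (simp del: of_nat_Suc)
  then have "binom_prod a (Suc n) + binom_prod (a - 1) (Suc n) =
      2 * sq_prod (Suc n) a - 2 * sq_prod n a"
    unfolding binom_prod_minus_1_Suc unfolding binom_prod_Suc sq_prod_Suc c_def[symmetric]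
    by (simp add: divide_simps) (simp add: algebra_simps power2_eq_square)
  then show ?case
    using Suc.IH by simp
qed

text \<open>The weights are chosen so that (2a + 1)(c + a) + (2a - 1)(c - a) = 2a(2c + 1): the odd
  denominator cancels and the increment is the same as for the unweighted sums.\<close>

lemma sum_binom_prod_odd_step:
  "(\<Sum>k\<le>n. binom_prod a k * (2 * a + 1) / (2 * of_nat k + 1)) -
   (\<Sum>k\<le>n. binom_prod (a - 1) k * (2 * (a - 1) + 1) / (2 * of_nat k + 1)) = 2 * sq_prod n a"
proof (induction n)
  case 0
  then show ?case
    by (simp add: binom_prod_def)
next
  case (Suc n)
  define c where "c = rat_of_nat (Suc n)"
  have "c > 0"
    unfolding c_def by (simp del: of_nat_Suc)
  then have "c \<noteq> 0" "2 * c + 1 \<noteq> 0"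
    by auto
  then have "binom_prod a (Suc n) * (2 * a + 1) / (2 * c + 1)
      - binom_prod (a - 1) (Suc n) * (2 * (a - 1) + 1) / (2 * c + 1) =
      2 * sq_prod (Suc n) a - 2 * sq_prod n a"
    unfolding binom_prod_minus_1_Suc unfolding binom_prod_Suc sq_prod_Suc c_def[symmetric]
    by (simp add: divide_simps) (simp add: algebra_simps power2_eq_square)
  then show ?case
    using Suc.IH unfolding sum.atMost_Suc c_def by linarith
qed

definition weighted_sum :: "nat \<Rightarrow> rat \<Rightarrow> rat" where
  "weighted_sum n a = (\<Sum>k\<le>n. binom_prod a k * ((a + of_nat k + 1) / (2 * of_nat k + 1)))"

text \<open>Uses 2(a + k + 1) = (2k + 1) + (2a + 1).\<close>

lemma weighted_sum_split:
  "2 * weighted_sum n a = (\<Sum>k\<le>n. binom_prod a k) +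
    (\<Sum>k\<le>n. binom_prod a k * (2 * a + 1) / (2 * of_nat k + 1))"
proof -
  have "2 * (binom_prod a k * ((a + of_nat k + 1) / (2 * of_nat k + 1))) =
      binom_prod a k + binom_prod a k * (2 * a + 1) / (2 * of_nat k + 1)" for k
  proof -
    have "2 * rat_of_nat k + 1 \<noteq> 0"
      by (metis add_eq_0_iff_both_eq_0 mult_nonneg_nonneg of_nat_0_le_iff zero_le_numeral
          add_nonneg_eq_0_iff zero_le_one zero_neq_one)
    then show ?thesis
      by (simp add: field_simps)
  qed
  then show ?thesis
    unfolding weighted_sum_def sum_distrib_left by (simp add: sum.distrib)
qed

text \<open>Two unit steps are combined. The unweighted part contributes 2Q(a) - 2Q(a - 1), the
  other part 2Q(a) + 2Q(a - 1), so the values at a - 1 cancel.\<close>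

lemma weighted_sum_step: "weighted_sum n a - weighted_sum n (a - 2) = 2 * sq_prod n a"
proof -
  have "a - 1 - 1 = a - 2"
    by simp
  then show ?thesis
    using weighted_sum_split[of n a] weighted_sum_split[of n "a - 2"]
      sum_binom_prod_step[of a n] sum_binom_prod_odd_step[of a n]
      sum_binom_prod_step[of "a - 1" n] sum_binom_prod_odd_step[of "a - 1" n]
    by simp
qed

lemma weighted_sum_0: "weighted_sum n 0 = 1"
  by (induction n) (auto simp: weighted_sum_def binom_prod_Suc binom_prod_def)

text \<open>The terms k = 0 and k = 1 are 2 and -2; all later ones contain the vanishing factor j =
  1 of \<open>sq_prod\<close>.\<close>

lemma weighted_sum_1: "weighted_sum (Suc n) 1 = 0"
proof (induction n)
  case 0
  have "binom_prod 1 (Suc 0) = -2"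
    by (simp add: binom_prod_Suc)
  then show ?case
    by (simp add: weighted_sum_def binom_prod_def)
next
  case (Suc n)
  have "sq_prod (Suc n) 1 = 0"
    unfolding sq_prod_def by (rule prod_zero) (auto intro!: bexI[of _ 1])
  then show ?case
    using Suc by (simp add: weighted_sum_def binom_prod_Suc)
qed

subsection \<open>The step function modulo \<open>p\<^sup>3\<close>\<close>

text \<open>Up to factorials both sides are a^2 times the product of (a - j)(a + j); one copy of a
  goes to each of the two falling factorials.\<close>

lemma sq_prod_gbinomial:
  "a ^ 2 * sq_prod n a * (-1) ^ n =
    of_nat (Suc n) ^ 2 * (a gchoose Suc n) * ((a + of_nat n) gchoose Suc n)"
proof (induction n)
  case 0
  then show ?case
    by (simp add: power2_eq_square)
next
  case (Suc n)
  define c where "c = rat_of_nat (Suc n)"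
  have c: "c \<noteq> 0" "1 + c \<noteq> 0" "c + 1 \<noteq> 0" "rat_of_nat (Suc (Suc n)) = c + 1"
    unfolding c_def by (simp_all del: of_nat_Suc add: of_nat_Suc[of "Suc n"])
  have 1: "a gchoose Suc (Suc n) = (a gchoose Suc n) * (a - c) / (c + 1)"
    using gbinomial_Suc_right[of a "Suc n"] c by (simp add: c_def)
  have "a + c = a + of_nat n + 1"
    by (simp add: c_def)
  then have 2: "(a + c) gchoose Suc (Suc n) = (a + c) / (c + 1) * ((a + of_nat n) gchoose Suc n)"
    using gbinomial_factors[of "a + of_nat n" "Suc n"] by (simp only: c)
  have "a ^ 2 * sq_prod (Suc n) a * (-1) ^ Suc n =
      (a ^ 2 * sq_prod n a * (-1) ^ n) * (a ^ 2 / c ^ 2 - 1)"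
    unfolding sq_prod_Suc c_def[symmetric] by (simp add: algebra_simps)
  also have "\<dots> = (c + 1) ^ 2 * (a gchoose Suc (Suc n)) * ((a + c) gchoose Suc (Suc n))"
  proof -
    have "c ^ 2 * X * Y * (a ^ 2 / c ^ 2 - 1) = (c + 1) ^ 2 * (X * (a - c) / (c + 1)) * ((a + c) / (c + 1) * Y)"
      for X Y
      using c(1-3) by (simp add: divide_simps) (simp add: algebra_simps power2_eq_square)
    then show ?thesis
      unfolding Suc.IH 1 2 c_def[symmetric] .
  qed
  finally show ?case
    unfolding c(4) unfolding c_def .
qed

text \<open>Induction in steps of p: passing from m to m + p raises both sides by 1 modulo
  p.\<close>

lemma choose_prime_cong:
  assumes p: "prime p"
  shows "[n choose p = n div p] (mod p)"
proof (induction n rule: less_induct)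
  case (less n)
  show ?case
  proof (cases "n < p")
    case False
    then obtain m where m: "n = m + p"
      by (metis add.commute le_Suc_ex not_less)
    have p0: "0 < p"
      using p prime_gt_0_nat by blast
    have "p dvd (m choose k) * (p choose (p - k))" if "k \<in> {1..<p}" for k
      using that p by (intro dvd_mult dvd_choose_prime) auto
    then have "p dvd (\<Sum>k\<in>{1..<p}. (m choose k) * (p choose (p - k)))"
      by (intro dvd_sum) auto
    then obtain q where q: "(\<Sum>k\<in>{1..<p}. (m choose k) * (p choose (p - k))) = p * q"
      by blast
    have "n choose p = (\<Sum>k\<le>p. (m choose k) * (p choose (p - k)))"
      unfolding m by (rule vandermonde[symmetric])
    \<comment> \<open>In the Vandermonde sum the inner terms are multiples of p; the ends k = 0 and
      k = p give 1 and \<open>m choose p\<close>.\<close>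
    also have "{..p} = insert 0 (insert p {1..<p})"
      using p0 by auto
    also have "(\<Sum>k\<in>\<dots>. (m choose k) * (p choose (p - k))) = 1 + (m choose p) + p * q"
      using p0 q by simp
    also have "[1 + (m choose p) + p * q = 1 + m div p + 0] (mod p)"
      using less.IH[of m] p0 m by (intro cong_add) (auto simp: cong_0_iff)
    finally show ?thesis
      using p0 by (simp add: m)
  qed (simp add: binomial_eq_0)
qed

context
  fixes p :: nat
  assumes p: "prime p" and p3: "p > 3"
begin

lemmas [trans] = cong_pow_trans[OF p]

lemma not_dvd_power2: "\<not> p dvd n \<Longrightarrow> \<not> p dvd n ^ 2"
  using p prime_dvd_power by blast

lemma p_odd: "odd p"
  using p p3 prime_odd_nat by auto

lemma not_dvd_2: "\<not> p dvd 2" and not_dvd_4: "\<not> p dvd 4"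
  using p3 p_odd p primes_dvd_imp_eq[of p 2] prime_dvd_mult_iff[of p 2 2] by auto

lemma Zloc_divide_2: "x \<in> Zloc p \<Longrightarrow> x / 2 \<in> Zloc p"
  and Zloc_divide_4: "x \<in> Zloc p \<Longrightarrow> x / 4 \<in> Zloc p"
  using Zloc_divide_nat[OF p, of x 2] Zloc_divide_nat[OF p, of x 4] not_dvd_2 not_dvd_4
  by simp_all

text \<open>The binomial identity for index p - 1 brings out a factor p^2, so the two binomials
  matter only modulo p. Dividing by n^2 is harmless as it is a unit.\<close>

lemma sq_prod_cong_nondvd:
  assumes n: "\<not> p dvd n"
  shows "cong_pow p 3 (sq_prod (p - 1) (of_nat n))
    (of_nat p ^ 2 * (of_nat (n div p) * (of_nat (n div p) + 1) / of_nat n ^ 2))"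
proof -
  define t where "t = n div p"
  have p0: "p > 0"
    using p3 by simp
  have n0: "rat_of_nat n \<noteq> 0"
    using n by (cases n) auto
  have "n mod p > 0" "n = p * t + n mod p"
    using n unfolding t_def by (auto simp: dvd_eq_mod_eq_0)
  \<comment> \<open>Since the residue of n is positive, adding p - 1 lowers it by one and raises the
    quotient to \<open>t + 1\<close>.\<close>
  then have "n + (p - 1) = (n mod p - 1) + p * (t + 1)"
    using p0 unfolding distrib_left by linarith
  then have div: "(n + (p - 1)) div p = t + 1"
    using p0 by (simp only: div_mult_self2 div_less less_imp_diff_less mod_less_divisor)
  have "[(n choose p) * ((n + (p - 1)) choose p) = t * (t + 1)] (mod p)"
    using choose_prime_cong[OF p, of n] choose_prime_cong[OF p, of "n + (p - 1)"]
    unfolding div t_def by (rule cong_mult)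
  then have c: "cong_pow p 1 (of_nat ((n choose p) * ((n + (p - 1)) choose p))) (of_nat (t * (t + 1)))"
    using cong_pow_of_nat_iff[OF p] by blast
  have "of_nat n ^ 2 * sq_prod (p - 1) (of_nat n) =
      of_nat p ^ 2 * rat_of_nat ((n choose p) * ((n + (p - 1)) choose p))"
  proof -
    have e: "Suc (p - 1) = p" "even (p - 1)"
      using p0 p_odd by auto
    have "rat_of_nat n + of_nat (p - 1) = of_nat (n + (p - 1))"
      by (rule of_nat_add[symmetric])
    then show ?thesis
      using sq_prod_gbinomial[of "of_nat n" "p - 1"] e
      by (simp only: of_nat_mult binomial_gbinomial mult.assoc power_minus_even power_one mult_1_right)
  qed
  then have "cong_pow p 3 (of_nat (n ^ 2) * sq_prod (p - 1) (of_nat n))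
      (of_nat p ^ 2 * of_nat (t * (t + 1)))"
    using cong_pow_lift[OF p c, of 2] by simp
  also have "of_nat p ^ 2 * of_nat (t * (t + 1)) =
      of_nat (n ^ 2) * (of_nat p ^ 2 * (of_nat t * (of_nat t + 1) / rat_of_nat n ^ 2))"
    using n0 by (simp add: field_simps)
  finally show ?thesis
    unfolding t_def[symmetric] by (rule cong_pow_cancel_nat[OF p _ not_dvd_power2[OF n]])
qed

text \<open>Expansion to first order; every product of two correction terms already carries
  p^4.\<close>

lemma prod_one_minus_cong:
  assumes "finite A" "\<And>j. j \<in> A \<Longrightarrow> x j \<in> Zloc p"
  shows "cong_pow p 4 (\<Prod>j\<in>A. 1 - of_nat p ^ 2 * x j) (1 - of_nat p ^ 2 * (\<Sum>j\<in>A. x j))"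
  using assms
proof (induction A)
  case (insert i A)
  let ?s = "\<Sum>j\<in>A. x j"
  have s: "?s \<in> Zloc p" "x i \<in> Zloc p"
    using insert by (auto intro!: Zloc_sum p)
  have "cong_pow p 4 ((1 - of_nat p ^ 2 * x i) * (\<Prod>j\<in>A. 1 - of_nat p ^ 2 * x j))
      ((1 - of_nat p ^ 2 * x i) * (1 - of_nat p ^ 2 * ?s))"
    using insert.IH insert.prems s p by (intro cong_pow_cmult) simp_all
  also have "cong_pow p 4 \<dots> (1 - of_nat p ^ 2 * (\<Sum>j\<in>insert i A. x j))"
  proof (rule cong_powI[OF p])
    show "(1 - of_nat p ^ 2 * x i) * (1 - of_nat p ^ 2 * ?s) =
        1 - of_nat p ^ 2 * (\<Sum>j\<in>insert i A. x j) + of_nat p ^ 4 * (x i * ?s)"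
      unfolding sum.insert[OF insert.hyps] by (simp add: algebra_simps eval_nat_numeral)
  qed (use s p in simp)
  finally show ?case
    unfolding prod.insert[OF insert.hyps] .
qed (simp add: p)

section \<open>The Bernoulli polynomial of index p - 2 modulo p\<close>

lemma bernoulli_zeros:
  "bernoulli_poly (p - 2) 0 = 0" "bernoulli_poly (p - 2) 1 = 0" "bernoulli_poly (p - 2) (1 / 2) = 0"
proof -
  have o: "odd (p - 2)" "p - 2 \<noteq> 1"
    using p_odd p3 by presburger+
  show "bernoulli_poly (p - 2) 0 = 0" "bernoulli_poly (p - 2) (1 / 2) = 0"
    using o bernoulli_poly_odd_0 bernoulli_poly_odd_half by auto
  then show "bernoulli_poly (p - 2) 1 = 0"
    using bernoulli_poly_reflect[of "p - 2" 0] by simp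
qed

text \<open>The difference is (2 - p) x^(p-3); the factor x^2 completes the power to x^(p-1), to
  which Fermat applies.\<close>

lemma bernoulli_poly_step_cong:
  assumes x: "x \<in> Zloc p" "\<not> cong_pow p 1 x 0"
  shows "cong_pow p 1 (x ^ 2 * (bernoulli_poly (p - 2) x - bernoulli_poly (p - 2) (x + 1))) 2"
proof -
  define m where "m = p - 3"
  have m: "p = m + 3"
    using p3 by (simp add: m_def)
  have "x ^ 2 * (bernoulli_poly (p - 2) x - bernoulli_poly (p - 2) (x + 1)) =
      (2 - of_nat p) * x ^ (p - 1)"
  proof -
    have "bernoulli_poly (p - 2) x - bernoulli_poly (p - 2) (x + 1) = (2 - of_nat p) * x ^ m"
    proof -
      have e: "p - 2 = Suc m" "2 - rat_of_nat p = - of_nat (Suc m)"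
        using m by simp_all
      show ?thesis
        unfolding e using bernoulli_poly_plus_1[of m x] by (simp add: algebra_simps del: of_nat_Suc)
    qed
    moreover have "p - 1 = 2 + m"
      using m by simp
    ultimately show ?thesis
      by (simp only: power_add mult.left_commute)
  qed
  also have "cong_pow p 1 \<dots> ((2 - of_nat p) * 1)"
    using fermat_Zloc[OF p x] p by (intro cong_pow_cmult) auto
  also have "cong_pow p 1 \<dots> 2"
    using p by (intro cong_powI[where z = "-1"]) auto
  finally show ?thesis
    using p by blast
qed

text \<open>By the preceding step, 2 / j^2 is a difference of consecutive Bernoulli values. The sum
  telescopes to the value at 1 minus the value at p, and the latter is congruent to the value at 0;
  both limits are zeros.\<close>

lemma sum_inverse_squares_cong: "cong_pow p 1 (\<Sum>j=1..p-1. 1 / of_nat j ^ 2) 0"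
proof -
  let ?b = "bernoulli_poly (p - 2)"
  have "cong_pow p 1 (2 * (1 / of_nat j ^ 2)) (?b (of_nat j) - ?b (of_nat (Suc j)))"
    if j: "j \<in> {1..p-1}" for j
  proof -
    have nd: "\<not> p dvd j"
      using j p3 by (auto dest: dvd_imp_le)
    then have "\<not> cong_pow p 1 (of_nat j) (0 :: rat)"
      using cong_pow_of_nat_iff[OF p, of j 0] by (simp add: cong_0_iff)
    then have "cong_pow p 1 (of_nat (j ^ 2) * (?b (of_nat j) - ?b (of_nat (Suc j)))) 2"
      using bernoulli_poly_step_cong[of "of_nat j"] p by (simp add: add.commute)
    also have "2 = of_nat (j ^ 2) * (2 * (1 / rat_of_nat j ^ 2))"
      using j by simp
    finally show ?thesis
      by (rule cong_pow_sym[OF p cong_pow_cancel_nat[OF p _ not_dvd_power2[OF nd]]])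
  qed
  then have "cong_pow p 1 (\<Sum>j=1..p-1. 2 * (1 / of_nat j ^ 2))
      (\<Sum>j=1..p-1. ?b (of_nat j) - ?b (of_nat (Suc j)))"
    by (rule cong_pow_sum[OF p])
  also have "(\<Sum>j=1..p-1. ?b (of_nat j) - ?b (of_nat (Suc j))) = - (\<Sum>j=1..p-1. ?b (of_nat (Suc j)) - ?b (of_nat j))"
    by (simp flip: sum_negf)
  also have "\<dots> = ?b 1 - ?b (of_nat p)"
    using p3 by (subst sum_Suc_diff) auto
  also have "cong_pow p 1 \<dots> (?b 1 - ?b 0)"
    using p p3 by (intro cong_pow_diff bernoulli_poly_cong) (auto intro: cong_powI[where z = 1])
  finally have "cong_pow p 1 (of_nat 2 * (\<Sum>j=1..p-1. 1 / of_nat j ^ 2)) (of_nat 2 * 0)"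
    using p by (simp add: bernoulli_zeros sum_distrib_left)
  then show ?thesis
    using cong_pow_cancel_nat p not_dvd_2 by blast
qed

text \<open>To first order the product is 1 - p^2 t^2 times the sum of 1 / j^2, and that sum is
  divisible by p.\<close>

lemma sq_prod_cong_dvd:
  assumes t: "t \<in> Zloc p"
  shows "cong_pow p 3 (sq_prod (p - 1) (of_nat p * t)) 1"
proof -
  have nd: "\<not> p dvd j ^ 2" if "j \<in> {1..p-1}" for j
    using that p3 by (intro not_dvd_power2) (auto dest: dvd_imp_le)
  have "t ^ 2 / of_nat (j ^ 2) \<in> Zloc p" if "j \<in> {1..p-1}" for j
    using nd[OF that] t p by (intro Zloc_divide_nat) auto
  then have "cong_pow p 4 (\<Prod>j=1..p-1. 1 - of_nat p ^ 2 * (t ^ 2 / of_nat (j ^ 2)))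
      (1 - of_nat p ^ 2 * (\<Sum>j=1..p-1. t ^ 2 / of_nat (j ^ 2)))"
    by (intro prod_one_minus_cong) auto
  then have "cong_pow p 4 (sq_prod (p - 1) (of_nat p * t))
      (1 - of_nat p ^ 2 * (\<Sum>j=1..p-1. t ^ 2 / of_nat (j ^ 2)))"
    by (simp only: sq_prod_def power_mult_distrib of_nat_power times_divide_eq_right)
  then have 1: "cong_pow p 3 (sq_prod (p - 1) (of_nat p * t))
      (1 - of_nat p ^ 2 * (\<Sum>j=1..p-1. t ^ 2 / of_nat (j ^ 2)))"
    using cong_pow_mono[OF p, of 4 _ _ 3] by simp
  have "cong_pow p 1 (t ^ 2 * (\<Sum>j=1..p-1. 1 / of_nat j ^ 2)) (t ^ 2 * 0)"
    using sum_inverse_squares_cong t p by (intro cong_pow_cmult) auto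
  then have "cong_pow p 3 (of_nat p ^ 2 * (\<Sum>j=1..p-1. t ^ 2 / of_nat (j ^ 2))) 0"
    using cong_pow_lift[OF p, of 1 _ _ 2] by (fastforce simp: sum_distrib_left)
  then have "cong_pow p 3 (1 - of_nat p ^ 2 * (\<Sum>j=1..p-1. t ^ 2 / of_nat (j ^ 2))) (1 - 0)"
    using p by (intro cong_pow_diff) auto
  then show ?thesis
    using 1 cong_pow_trans[OF p] by simp
qed

section \<open>The closed form at natural numbers\<close>

definition closed_form :: "rat \<Rightarrow> nat \<Rightarrow> rat \<Rightarrow> rat" where
  "closed_form a r t = (1 + (-1) ^ r) / 2 + t +
    of_nat p ^ 2 * (t * (t + 1) / 4) * bernoulli_poly (p - 2) (- a / 2)"

lemma closed_form_step:
  defines "f \<equiv> \<lambda>n. closed_form (of_nat n) (n mod p) (of_nat (n div p))"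
  shows "cong_pow p 3 (f (n + 2) - f n) (2 * sq_prod (p - 1) (of_nat (n + 2)))"
proof -
  let ?b = "bernoulli_poly (p - 2)"
  define m where "m = n + 2"
  define r where "r = m mod p"
  define t where "t = m div p"
  define T where "T = rat_of_nat t"
  define x where "x = - rat_of_nat m / 2"
  have p0: "p > 0"
    using p3 by simp
  have m: "m = p * t + r" and rp: "r < p"
    unfolding r_def t_def using p0 by auto
  have xm: "x + 1 = - rat_of_nat n / 2"
    unfolding x_def m_def by (simp add: field_simps)
  have m0: "rat_of_nat m \<noteq> 0"
    unfolding m_def of_nat_eq_0_iff by simp
  have x: "x \<in> Zloc p"
    unfolding x_def using p by (intro Zloc_divide_2) auto
  have T: "T \<in> Zloc p"
    unfolding T_def using p by auto
  have fm: "f m = (1 + (-1) ^ r) / 2 + T + of_nat p ^ 2 * (T * (T + 1) / 4) * ?b x"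
    unfolding f_def closed_form_def r_def t_def T_def x_def by simp
  have div_mod: "(q + p * s) mod p = q" "(q + p * s) div p = s" if "q < p" for q s
    using that p0 by simp_all
  have fn0: "f n = (1 + (-1) ^ (n mod p)) / 2 + of_nat (n div p) +
      of_nat p ^ 2 * (of_nat (n div p) * (of_nat (n div p) + 1) / 4) * ?b (x + 1)"
    unfolding f_def closed_form_def xm ..
  \<comment> \<open>Here x^2 = m^2 / 4, which turns the constant 2 of the Bernoulli step into 8 /
    m^2.\<close>
  have b_step: "cong_pow p 1 (?b x - ?b (x + 1)) (8 / of_nat m ^ 2)" if nd: "\<not> p dvd m"
  proof -
    have "\<not> cong_pow p 1 x 0"
    proof
      assume "cong_pow p 1 x 0"
      then have "cong_pow p 1 (-2 * x) (-2 * 0)"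
        using p by (intro cong_pow_cmult) auto
      then show False
        using nd cong_pow_of_nat_iff[OF p, of m 0] by (simp add: x_def cong_0_iff)
    qed
    then have "cong_pow p 1 (4 * (x ^ 2 * (?b x - ?b (x + 1)))) (4 * 2)"
      using x p bernoulli_poly_step_cong by (intro cong_pow_cmult) auto
    also have "4 * (x ^ 2 * (?b x - ?b (x + 1))) = of_nat (m ^ 2) * (?b x - ?b (x + 1))"
      by (simp add: x_def power_divide)
    also have "4 * 2 = of_nat (m ^ 2) * (8 / rat_of_nat m ^ 2)"
      using m0 by simp
    finally show ?thesis
      by (rule cong_pow_cancel_nat[OF p _ not_dvd_power2[OF nd]])
  qed
  have lift: "cong_pow p 3 (of_nat p ^ 2 * (c * u)) (of_nat p ^ 2 * (c * v))"
    if "cong_pow p 1 u v" "c \<in> Zloc p" for c u v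
    using cong_pow_lift[OF p cong_pow_cmult[OF p that], of 2] by simp
  have sq: "cong_pow p 3 (2 * sq_prod (p - 1) (of_nat m))
      (of_nat p ^ 2 * (T * (T + 1) / 4 * (8 / of_nat m ^ 2)))" if "\<not> p dvd m"
  proof -
    have e: "of_nat p ^ 2 * (T * (T + 1) / 4 * (8 / of_nat m ^ 2)) =
        2 * (of_nat p ^ 2 * (T * (T + 1) / rat_of_nat m ^ 2))"
      by simp
    show ?thesis
      unfolding e unfolding T_def t_def
      by (rule cong_pow_cmult[OF p sq_prod_cong_nondvd[OF that] Zloc_numeral[OF p]])
  qed
  have TT: "T * (T + 1) / 4 \<in> Zloc p" "T * (T - 1) / 4 \<in> Zloc p"
    using T p by (auto intro!: Zloc_divide_4)
  \<comment> \<open>Going from n to m = n + 2 changes the quotient by p only if the residue of m is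
    0 or 1.\<close>
  consider "r \<ge> 2" | "r = 0" | "r = 1"
    by linarith
  then have "cong_pow p 3 (f m - f n) (2 * sq_prod (p - 1) (of_nat m))"
  proof cases
    case 1
    then have nd: "\<not> p dvd m"
      unfolding r_def by auto
    have n: "n = r - 2 + p * t"
      using m m_def 1 by simp
    then have "n mod p = r - 2" "n div p = t"
      using rp by auto
    moreover have "(-1 :: rat) ^ (r - 2) = (-1) ^ r"
      using 1 by (simp add: minus_one_power_iff)
    ultimately have "f m - f n = of_nat p ^ 2 * (T * (T + 1) / 4 * (?b x - ?b (x + 1)))"
      unfolding fm fn0 by (simp add: T_def right_diff_distrib)
    also have "cong_pow p 3 \<dots> (of_nat p ^ 2 * (T * (T + 1) / 4 * (8 / of_nat m ^ 2)))"
      using lift b_step[OF nd] TT by blast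
    also have "cong_pow p 3 \<dots> (2 * sq_prod (p - 1) (of_nat m))"
      using sq[OF nd] cong_pow_sym p by blast
    finally show ?thesis
      using p by blast
  next
    \<comment> \<open>The residue falls from the odd p - 2 to 0: the parity term and the quotient
      each grow by 1, giving 2. The Bernoulli terms vanish modulo p, since x and x + 1 are congruent
      to 0 and 1.\<close>
    case 2
    then obtain s where s: "t = Suc s"
      using m m_def by (cases t) auto
    have Ts: "T = of_nat s + 1"
      by (simp add: T_def s)
    have n: "n = (p - 2) + p * s"
      using m m_def 2 s p3 by simp
    have "n mod p = p - 2" "n div p = s"
      unfolding n by (intro div_mod; use p3 in simp)+
    moreover have "(-1 :: rat) ^ (p - 2) = -1"
      using p_odd p3 by (simp add: minus_one_power_iff)
    ultimately have fn: "f n = T - 1 + of_nat p ^ 2 * (T * (T - 1) / 4 * ?b (x + 1))"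
      unfolding fn0 by (simp add: Ts mult.commute)
    have xT: "x = of_nat p * (- T / 2)"
      by (simp add: x_def m 2 T_def)
    have "cong_pow p 1 (?b x) (?b 0)"
      using p p3 T by (intro bernoulli_poly_cong)
        (auto intro!: cong_powI[where z = "- T / 2"] Zloc_divide_2 simp: xT)
    then have b0: "cong_pow p 3 (of_nat p ^ 2 * (T * (T + 1) / 4 * ?b x)) 0"
      using lift[OF _ TT(1)] by (fastforce simp: bernoulli_zeros)
    have "cong_pow p 1 (?b (x + 1)) (?b 1)"
      using p p3 T by (intro bernoulli_poly_cong)
        (auto intro!: cong_powI[where z = "- T / 2"] Zloc_divide_2 simp: xT)
    then have b1: "cong_pow p 3 (of_nat p ^ 2 * (T * (T - 1) / 4 * ?b (x + 1))) 0"
      using lift[OF _ TT(2)] by (fastforce simp: bernoulli_zeros)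
    have "cong_pow p 3 (2 + (of_nat p ^ 2 * (T * (T + 1) / 4 * ?b x)
        - of_nat p ^ 2 * (T * (T - 1) / 4 * ?b (x + 1)))) (2 + (0 - 0))"
      using p b0 b1 by (intro cong_pow_add cong_pow_diff) auto
    then have "cong_pow p 3 (f m - f n) (2 * 1)"
      unfolding fm fn by (simp add: 2 algebra_simps)
    moreover have "cong_pow p 3 (2 * 1) (2 * sq_prod (p - 1) (of_nat m))"
      using sq_prod_cong_dvd[OF T] cong_pow_sym p
      by (intro cong_pow_cmult) (auto simp: m 2 T_def)
    ultimately show ?thesis
      using p cong_pow_trans by blast
  next
    \<comment> \<open>The residue falls from the even p - 1 to 1: the parity term loses what the
      quotient gains. As x + 1 is congruent to 1/2, a zero, the value at x alone equals the whole
      Bernoulli step.\<close>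
    case 3
    then have nd: "\<not> p dvd m"
      unfolding r_def by auto
    obtain s where s: "t = Suc s"
      using m m_def 3 by (cases t) auto
    have Ts: "T = of_nat s + 1"
      by (simp add: T_def s)
    have n: "n = (p - 1) + p * s"
      using m m_def 3 s p3 by simp
    have "n mod p = p - 1" "n div p = s"
      unfolding n by (intro div_mod; use p3 in simp)+
    moreover have "(-1 :: rat) ^ (p - 1) = 1"
      using p_odd p3 by (simp add: minus_one_power_iff)
    ultimately have fn: "f n = T + of_nat p ^ 2 * (T * (T - 1) / 4 * ?b (x + 1))"
      unfolding fn0 by (simp add: Ts mult.commute)
    have xT: "x + 1 = 1 / 2 + of_nat p * (- T / 2)"
      by (simp add: x_def m 3 T_def field_simps)
    have "cong_pow p 1 (?b (x + 1)) (?b (1 / 2))"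
      unfolding xT using p p3 T
      by (intro bernoulli_poly_cong) (auto intro!: cong_powI[where z = "- T / 2"] Zloc_divide_2)
    then have b1: "cong_pow p 1 (?b (x + 1)) 0"
      by (simp add: bernoulli_zeros)
    have "cong_pow p 1 ((?b x - ?b (x + 1)) + ?b (x + 1)) (8 / of_nat m ^ 2 + 0)"
      using p b_step[OF nd] b1 by (intro cong_pow_add)
    then have b0: "cong_pow p 1 (?b x) (8 / of_nat m ^ 2)"
      by simp
    have "cong_pow p 3 (of_nat p ^ 2 * (T * (T + 1) / 4 * ?b x)
        - of_nat p ^ 2 * (T * (T - 1) / 4 * ?b (x + 1)))
        (of_nat p ^ 2 * (T * (T + 1) / 4 * (8 / of_nat m ^ 2)) - of_nat p ^ 2 * (T * (T - 1) / 4 * 0))"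
      by (intro cong_pow_diff[OF p] lift b0 b1 TT)
    then have "cong_pow p 3 (f m - f n) (of_nat p ^ 2 * (T * (T + 1) / 4 * (8 / of_nat m ^ 2)))"
      unfolding fm fn by (simp add: 3 algebra_simps)
    also have "cong_pow p 3 \<dots> (2 * sq_prod (p - 1) (of_nat m))"
      using sq[OF nd] cong_pow_sym p by blast
    finally show ?thesis
      using p by blast
  qed
  then show ?thesis
    by (simp only: m_def)
qed

lemma weighted_sum_nat:
  "cong_pow p 3 (weighted_sum (p - 1) (of_nat n)) (closed_form (of_nat n) (n mod p) (of_nat (n div p)))"
proof (induction n rule: less_induct)
  case (less n)
  let ?f = "\<lambda>n. closed_form (of_nat n) (n mod p) (of_nat (n div p))"
  consider "n = 0" | "n = 1" | k where "n = k + 2"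
    by (metis One_nat_def add_2_eq_Suc' not0_implies_Suc)
  then show ?case
  proof cases
    case 1
    then show ?thesis
      using p by (simp add: weighted_sum_0 closed_form_def)
  next
    case 2
    have "p - 1 = Suc (p - 2)"
      using p3 by simp
    then show ?thesis
      using 2 p p3 weighted_sum_1[of "p - 2"] by (simp add: closed_form_def)
  next
    case (3 k)
    have "weighted_sum (p - 1) (of_nat n) =
        weighted_sum (p - 1) (of_nat k) + 2 * sq_prod (p - 1) (of_nat (k + 2))"
      using weighted_sum_step[of "p - 1" "of_nat n"] 3 by simp
    also have "cong_pow p 3 \<dots> (?f k + (?f (k + 2) - ?f k))"
      using less.IH[of k] 3 p closed_form_step[of k]
      by (intro cong_pow_add cong_pow_sym[OF p closed_form_step]) auto
    finally show ?thesis
      using 3 p by simp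
  qed
qed

section \<open>Continuity in a with respect to p\<close>

lemma gbinomial_cong:
  "cong_pow p m x y \<Longrightarrow> y \<in> Zloc p \<Longrightarrow> k < p \<Longrightarrow>
    cong_pow p m (x gchoose k) (y gchoose k) \<and> y gchoose k \<in> Zloc p"
proof (induction k)
  case (Suc k)
  \<comment> \<open>Below index p all denominators of the binomials are units, so no precision is
    lost.\<close>
  have nd: "\<not> p dvd Suc k"
    using Suc.prems by (auto dest: dvd_imp_le)
  have IH: "cong_pow p m (x gchoose k) (y gchoose k)" "y gchoose k \<in> Zloc p"
    using Suc by auto
  have "y gchoose Suc k \<in> Zloc p"
    unfolding gbinomial_Suc_right using Suc.prems nd IH p by (intro Zloc_divide_nat Zloc_mult) auto
  moreover have "cong_pow p m (of_nat (Suc k) * (x gchoose Suc k)) (of_nat (Suc k) * (y gchoose Suc k))"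
    unfolding gbinomial_Suc_right using Suc.prems IH p
    by (auto simp del: of_nat_Suc intro!: cong_pow_mult cong_pow_diff)
  ultimately show ?case
    using cong_pow_cancel_nat[OF p _ nd] by blast
qed (auto simp: p)

lemma weighted_sum_cong:
  assumes "cong_pow p (Suc m) x y" "y \<in> Zloc p"
  shows "cong_pow p m (weighted_sum (p - 1) x) (weighted_sum (p - 1) y)"
  unfolding weighted_sum_def
proof (rule cong_pow_sum[OF p])
  fix k
  assume "k \<in> {..p-1}"
  then have k: "k < p"
    using p3 by auto
  have c: "cong_pow p (Suc m) (-1 - x) (-1 - y)"
    using assms p by (intro cong_pow_diff) auto
  have "cong_pow p (Suc m) (binom_prod x k * (x + of_nat k + 1)) (binom_prod y k * (y + of_nat k + 1))"
    unfolding binom_prod_def using assms p k c gbinomial_cong[of "Suc m" x y k]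
      gbinomial_cong[OF c _ k]
    by (intro cong_pow_mult cong_pow_add) auto
  then obtain z where z: "z \<in> Zloc p" "binom_prod x k * (x + of_nat k + 1) =
      binom_prod y k * (y + of_nat k + 1) + of_nat p ^ Suc m * z"
    using cong_pow_iff[OF p] by blast
  define d where "d = 2 * k + 1"
  have d0: "rat_of_nat d \<noteq> 0"
    unfolding d_def of_nat_eq_0_iff by simp
  \<comment> \<open>A multiple of p below 2p is p itself, so one factor p absorbs the denominator.
    This is the power by which the modulus drops.\<close>
  have "of_nat p / of_nat d \<in> Zloc p"
  proof (cases "p dvd d")
    case True
    then obtain e where e: "d = p * e"
      by auto
    moreover have "d < p * 2"
      using k by (simp add: d_def)
    moreover have "d > 0"
      by (simp add: d_def)
    ultimately have "e = 1"
      by (cases e) auto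
    then show ?thesis
      using e d0 p by simp
  qed (use p in \<open>auto intro: Zloc_divide_nat\<close>)
  then have "z * (of_nat p / of_nat d) \<in> Zloc p"
    using z p by blast
  moreover have "2 * rat_of_nat k + 1 = of_nat d"
    by (simp add: d_def)
  ultimately show "cong_pow p m (binom_prod x k * ((x + of_nat k + 1) / (2 * of_nat k + 1)))
      (binom_prod y k * ((y + of_nat k + 1) / (2 * of_nat k + 1)))"
    using z d0 by (intro cong_powI[OF p, where z = "z * (of_nat p / of_nat d)"])
      (auto simp: field_simps)
qed

text \<open>The residue \<open>r\<close> is an argument of its own and stays fixed; the rest is
  polynomial in \<open>x\<close> and \<open>t\<close> with coefficients integral at p.\<close>

lemma closed_form_cong:
  assumes "cong_pow p 3 x y" "y \<in> Zloc p" "cong_pow p 3 t u" "u \<in> Zloc p"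
  shows "cong_pow p 3 (closed_form x r t) (closed_form y r u)"
proof -
  have half: "(1 / 2 :: rat) \<in> Zloc p" "(1 / 4 :: rat) \<in> Zloc p"
    using p by (auto intro: Zloc_divide_2 Zloc_divide_4)
  have "cong_pow p 3 ((- 1 / 2) * x) ((- 1 / 2) * y)"
    using assms half p by (intro cong_pow_cmult) (auto intro!: Zloc_divide_2)
  then have b: "cong_pow p 3 (bernoulli_poly (p - 2) (- x / 2)) (bernoulli_poly (p - 2) (- y / 2))"
    "bernoulli_poly (p - 2) (- y / 2) \<in> Zloc p"
    using p p3 assms
    by (auto intro!: bernoulli_poly_cong bernoulli_poly_Zloc Zloc_divide_2)
  have q: "cong_pow p 3 (t * (t + 1)) (u * (u + 1))" "u * (u + 1) \<in> Zloc p"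
    using p assms by (auto intro!: cong_pow_mult cong_pow_add)
  have q': "cong_pow p 3 (t * (t + 1) / 4) (u * (u + 1) / 4)" "u * (u + 1) / 4 \<in> Zloc p"
    using cong_pow_cmult[OF p q(1) half(2)] Zloc_divide_4[OF q(2)] by simp_all
  show ?thesis
    unfolding closed_form_def
    by (intro cong_pow_add[OF p] cong_pow_mult[OF p] cong_pow_refl[OF p]
        Zloc_mult[OF p] Zloc_power[OF p] Zloc_of_nat[OF p] assms b q')
qed

end

section \<open>Passage from natural numbers to the local ring\<close>

theorem theorem3p5:
  fixes p :: nat and a t :: rat
  assumes "prime p" and "p > 3"
    and "a \<in> Zloc p"
    and "\<not> cong_pow p 1 (2 * a + 1) 0"
    and "t = (a - of_nat (least_res p a)) / of_nat p"
  shows "cong_pow p 3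
    (\<Sum>k=0..p-1. (a gchoose k) * ((-1 - a) gchoose k) *
        ((a + of_nat k + 1) / (2 * of_nat k + 1)))
    ((1 + (-1) ^ least_res p a) / 2 + t +
        of_nat p ^ 2 * (t * (t + 1) / 4) * bernoulli_poly (p - 2) (- a / 2))"
proof -
  note p = assms(1) and p3 = assms(2)
  have p0: "rat_of_nat p \<noteq> 0"
    using p3 by simp
  obtain n where n: "cong_pow p 4 a (of_nat n)"
    using Zloc_approx[OF p assms(3)] .
  have r: "least_res p a = n mod p"
    using least_res_eq[OF p n] by simp
  have "cong_pow p 3 t (of_nat (n div p))"
  proof -
    obtain z where z: "z \<in> Zloc p" "a = of_nat n + of_nat p ^ 4 * z"
      using n cong_pow_iff[OF p] by blast
    have "rat_of_nat n = of_nat p * of_nat (n div p) + of_nat (n mod p)"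
      by (metis mult_div_mod_eq of_nat_add of_nat_mult)
    \<comment> \<open>Subtracting the common residue from a and dividing by p turns the error p^4 z
      into p^3 z.\<close>
    then have "t = of_nat (n div p) + of_nat p ^ 3 * z"
      unfolding assms(5) r unfolding z(2) using p0 by (simp add: field_simps eval_nat_numeral)
    then show ?thesis
      using z p cong_powI by blast
  qed
  then have "cong_pow p 3 (closed_form p a (n mod p) t)
      (closed_form p (of_nat n) (n mod p) (of_nat (n div p)))"
    using n p p3 cong_pow_mono[OF p n, of 3] by (intro closed_form_cong) auto
  then have "cong_pow p 3 (closed_form p (of_nat n) (n mod p) (of_nat (n div p)))
      (closed_form p a (n mod p) t)"
    using p cong_pow_sym by blast
  moreover have "cong_pow p 3 (weighted_sum (p - 1) a) (weighted_sum (p - 1) (of_nat n))"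
    using n p p3 by (intro weighted_sum_cong) (auto simp: numeral_eq_Suc)
  ultimately have "cong_pow p 3 (weighted_sum (p - 1) a) (closed_form p a (n mod p) t)"
    using weighted_sum_nat[OF p p3, of n] cong_pow_trans[OF p] by blast
  then show ?thesis
    unfolding r weighted_sum_def binom_prod_def closed_form_def[OF p p3] atLeast0AtMost .
qed

end
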